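(* Let $\lambda$ be a nonzero real number and let $Y_1,Y_2$ be independent random variables, each having a moment generating function that exists in a neighborhood of the origin. Then for all integers $n\ge0$ and real $x,y$, \[ S_{n,\lambda}^{Y_1+Y_2}(x+y)=\sum_{k=0}^{n}\binom{n}{k}S_{k,\lambda}^{Y_1}(x)\,S_{n-k,\lambda}^{Y_2}(y). \] In particular (taking $y=0$ and $Y_2=0$), \[ S_{n,\lambda}^{Y_1}(x)=\sum_{k=0}^{n}\binom{n}{k}S_{k,\lambda}^{Y_1}(0)\,(x)_{n-k,\lambda}. \]
   Context: For a nonzero real $\lambda$ and any $x$, set $(x)_{0,\lambda}=1$ and $(x)_{n,\lambda}=x(x-\lambda)\cdots(x-(n-1)\lambda)$ for $n\ge1$, and $e_{\lambda}^{x}(t)=\sum_{k\ge0}(x)_{k,\lambda}\frac{t^k}{k!}=(1+\lambda t)^{x/\lambda}$. For a random variable $Y$ with $E[e^{Yt}]<\infty$ for $|t|<r$ (some $r>0$), $E[e_\lambda^Y(t)]=E[(1+\lambda t)^{Y/\lambda}]$ is analytic near $t=0$ with value $1$ at $0$, and the degenerate Sheffer polynomials associated with $Y$ are defined by $\frac{1}{E[e_\lambda^{Y}(t)]}\,e_\lambda^x(t)=\sum_{n\ge0}S_{n,\lambda}^{Y}(x)\frac{t^n}{n!}$. Here $Y_2=0$ denotes the constant random variable $0$. *)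

theory Defs
  imports "HOL-Probability.Probability"
begin

definition degenerate_fall :: "real \<Rightarrow> real \<Rightarrow> nat \<Rightarrow> real" where
  "degenerate_fall lam x n = (\<Prod>i<n. x - real i * lam)"

definition degenerate_exp :: "real \<Rightarrow> real \<Rightarrow> real \<Rightarrow> real" where
  "degenerate_exp lam x t = (\<Sum>k. degenerate_fall lam x k * t ^ k / fact k)"

text \<open>The closed form below holds on the disc of convergence; the value of \<^const>\<open>degenerate_exp\<close>
  outside of it is irrelevant, since only germs at \<open>t = 0\<close> are used.\<close>

lemma degenerate_fall_conv_gbinomial:
  assumes "lam \<noteq> 0"
  shows "degenerate_fall lam x k / fact k = ((x / lam) gchoose k) * lam ^ k"
proof -
  have "degenerate_fall lam x k = (\<Prod>i<k. (x / lam - real i) * lam)"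
    unfolding degenerate_fall_def using assms by (intro prod.cong) (auto simp: field_simps)
  also have "\<dots> = (\<Prod>i<k. x / lam - real i) * lam ^ k"
    by (simp add: prod.distrib)
  finally show ?thesis
    by (simp add: gbinomial_prod_rev atLeast0LessThan)
qed

lemma degenerate_exp_sums:
  assumes "lam \<noteq> 0" "\<bar>lam * t\<bar> < 1"
  shows "(\<lambda>k. degenerate_fall lam x k * t ^ k / fact k) sums ((1 + lam * t) powr (x / lam))"
proof -
  have "degenerate_fall lam x k * t ^ k / fact k = ((x / lam) gchoose k) * (lam * t) ^ k" for k
    using degenerate_fall_conv_gbinomial[OF assms(1), of x k] by (simp add: power_mult_distrib field_simps)
  then show ?thesis
    using gen_binomial_real[OF assms(2), of "x / lam"] by simp
qed

lemma degenerate_exp_eq_powr: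
  assumes "lam \<noteq> 0" "\<bar>lam * t\<bar> < 1"
  shows "degenerate_exp lam x t = (1 + lam * t) powr (x / lam)"
  unfolding degenerate_exp_def using degenerate_exp_sums[OF assms] by (rule sums_unique[symmetric])

definition mgf_near_0 :: "'a measure \<Rightarrow> ('a \<Rightarrow> real) \<Rightarrow> bool" where
  "mgf_near_0 M Y \<longleftrightarrow> (\<exists>r>0. \<forall>t. \<bar>t\<bar> < r \<longrightarrow> integrable M (\<lambda>\<omega>. exp (Y \<omega> * t)))"

definition sheffer_gf :: "'a measure \<Rightarrow> real \<Rightarrow> ('a \<Rightarrow> real) \<Rightarrow> real \<Rightarrow> real \<Rightarrow> real" where
  "sheffer_gf M lam Y x t =
     1 / prob_space.expectation M (\<lambda>\<omega>. degenerate_exp lam (Y \<omega>) t) * degenerate_exp lam x t"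

text \<open>The sequence of values \<open>S\<^sub>n(x)\<close>, \<open>n = 0, 1, \<dots>\<close>, is the one for which
  \<open>\<Sum>n. S\<^sub>n(x) t\<^sup>n / n!\<close> represents the generating function in a neighbourhood of \<open>t = 0\<close>.
  There is at most one such sequence; it exists when \<open>Y\<close> has a moment generating function near
  the origin.\<close>

definition sheffer :: "'a measure \<Rightarrow> real \<Rightarrow> ('a \<Rightarrow> real) \<Rightarrow> nat \<Rightarrow> real \<Rightarrow> real" where
  "sheffer M lam Y n x =
     (THE S. sheffer_gf M lam Y x has_fps_expansion Abs_fps (\<lambda>n. S n / fact n)) n"

lemma has_fps_expansion_unique_real:
  fixes f :: "real \<Rightarrow> real"
  assumes F: "f has_fps_expansion F" and G: "f has_fps_expansion G"
  shows "F = G"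
proof -
  define D where "D = F - G"
  have "(\<lambda>t. f t - f t) has_fps_expansion D"
    unfolding D_def by (intro has_fps_expansion_diff F G)
  then have rad: "fps_conv_radius D > 0" and ev: "eventually (\<lambda>t. eval_fps D t = 0) (nhds 0)"
    by (simp_all add: has_fps_expansion_def)
  have "eventually (\<lambda>t::real. t \<in> eball 0 (fps_conv_radius D)) (nhds 0)"
    using rad by (intro eventually_nhds_in_open) (simp_all add: in_eball_iff zero_ereal_def)
  with ev have "eventually (\<lambda>t::real. eval_fps D t = 0 \<and> ereal (norm t) < fps_conv_radius D) (nhds 0)"
    by eventually_elim (simp add: in_eball_iff)
  then obtain s where s: "s > 0"
    "\<And>t::real. norm t < s \<Longrightarrow> eval_fps D t = 0 \<and> ereal (norm t) < fps_conv_radius D"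
    unfolding eventually_nhds_metric dist_norm by auto
  have sums0: "(\<lambda>n. fps_nth D n * t ^ n) sums 0" if "norm t < s" for t
    using sums_eval_fps[of t D] s(2)[OF that] by simp
  have "fps_nth D n = 0" for n
  proof (induction n rule: less_induct)
    case (less n)
    have "(\<lambda>k. fps_nth D (k + n) * t ^ k) sums 0" if "t \<noteq> 0" "norm t < s" for t
    proof -
      have "(\<lambda>k. fps_nth D (k + n) * t ^ (k + n)) sums 0"
        using sums_split_initial_segment[OF sums0[OF that(2)], of n] less by simp
      then have "(\<lambda>k. fps_nth D (k + n) * t ^ (k + n) / t ^ n) sums (0 / t ^ n)"
        by (rule sums_divide)
      with that show ?thesis by (simp add: power_add)
    qed
    then have "((\<lambda>_. 0) \<longlongrightarrow> fps_nth D (0 + n)) (at (0::real))"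
      by (intro powser_limit_0_strong[OF s(1)]) auto
    then show ?case
      by (simp add: tendsto_const_iff)
  qed
  then have "D = 0" by (simp add: fps_eq_iff)
  then show ?thesis by (simp add: D_def)
qed

lemma sheffer_eqI:
  assumes "sheffer_gf M lam Y x has_fps_expansion Abs_fps (\<lambda>n. S n / fact n)"
  shows "sheffer M lam Y n x = S n"
proof -
  let ?P = "\<lambda>T. sheffer_gf M lam Y x has_fps_expansion Abs_fps (\<lambda>n. T n / fact n)"
  have uniq: "T = S" if "?P T" for T
  proof
    fix m
    have "Abs_fps (\<lambda>n. T n / fact n) = Abs_fps (\<lambda>n. S n / fact n)"
      by (rule has_fps_expansion_unique_real[OF that assms])
    from arg_cong[OF this, of "\<lambda>F. fps_nth F m"] show "T m = S m"
      by simp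
  qed
  have "The ?P = S"
    by (rule the_equality[of ?P, OF assms uniq])
  then show ?thesis
    unfolding sheffer_def by (rule fun_cong)
qed

end

(* The degenerate exponential is multiplicative, e^{x+y}(t) = e^x(t) e^y(t), and by independence so is
   its expectation, E[e^{Y1+Y2}(t)] = E[e^{Y1}(t)] E[e^{Y2}(t)].  Hence the generating function of
   Y1 + Y2 at x + y is the product of those of Y1 at x and Y2 at y, and the identity is the
   Cauchy product.  The analytic input is that E[e^Y(t)] is a power series near 0; this
   follows by dominated convergence from
   sum_k |(y)_k t^k / k!| <= (1 - |lam t|) powr (- |y| / |lam|) = exp (c |y|), where c -> 0 as t -> 0. *)

theory Submission
  imports Defs
begin

section \<open>Absolute convergence of the degenerate exponential series\<close>

lemma abs_degenerate_fall_le: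
  "\<bar>degenerate_fall lam y k\<bar> \<le> degenerate_fall (- \<bar>lam\<bar>) \<bar>y\<bar> k"
proof -
  have "\<bar>y - real i * lam\<bar> \<le> \<bar>y\<bar> - real i * - \<bar>lam\<bar>" for i
    using abs_triangle_ineq4[of y "real i * lam"] by (simp add: abs_mult)
  then show ?thesis
    unfolding degenerate_fall_def abs_prod by (intro prod_mono) auto
qed

text \<open>With step \<open>- \<bar>lam\<bar>\<close> every factor becomes
  \<open>\<bar>y\<bar> + i * \<bar>lam\<bar>\<close>, so the majorant is itself a degenerate
  exponential series with a closed form. Writing its sum as an exponential linear in
  \<open>\<bar>y\<bar>\<close> makes it comparable with a moment generating function.\<close>

lemma degenerate_majorant_sums:
  assumes "lam \<noteq> 0" "\<bar>lam * t\<bar> < 1"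
  shows "(\<lambda>k. degenerate_fall (- \<bar>lam\<bar>) \<bar>y\<bar> k * \<bar>t\<bar> ^ k / fact k)
           sums exp (\<bar>y\<bar> * (- ln (1 - \<bar>lam * t\<bar>) / \<bar>lam\<bar>))"
proof -
  have "(1 - \<bar>lam * t\<bar>) powr (\<bar>y\<bar> / - \<bar>lam\<bar>) = exp (\<bar>y\<bar> * (- ln (1 - \<bar>lam * t\<bar>) / \<bar>lam\<bar>))"
    using assms by (simp add: powr_def)
  then show ?thesis
    using degenerate_exp_sums[of "- \<bar>lam\<bar>" "\<bar>t\<bar>" "\<bar>y\<bar>"] assms by (simp add: abs_mult)
qed

lemma degenerate_term_le:
  "\<bar>degenerate_fall lam y k * t ^ k / fact k\<bar>
     \<le> degenerate_fall (- \<bar>lam\<bar>) \<bar>y\<bar> k * \<bar>t\<bar> ^ k / fact k"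
  by (simp add: abs_mult power_abs divide_right_mono mult_right_mono abs_degenerate_fall_le)

text \<open>An arbitrary finite index set covers both uses: singletons bound the terms, initial
  segments bound the partial sums.\<close>

lemma sum_abs_degenerate_le_exp:
  assumes "lam \<noteq> 0" "\<bar>lam * t\<bar> < 1" "finite A"
  shows "(\<Sum>k\<in>A. \<bar>degenerate_fall lam y k * t ^ k / fact k\<bar>)
           \<le> exp (\<bar>y\<bar> * (- ln (1 - \<bar>lam * t\<bar>) / \<bar>lam\<bar>))"
proof -
  let ?g = "\<lambda>k. degenerate_fall (- \<bar>lam\<bar>) \<bar>y\<bar> k * \<bar>t\<bar> ^ k / fact k"
  note s = degenerate_majorant_sums[OF assms(1,2), of y]
  have "0 \<le> ?g k" for k
    using degenerate_term_le[of lam y k t] by linarith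
  then have "sum ?g A \<le> suminf ?g"
    using s assms(3) by (intro sum_le_suminf) (auto simp: sums_iff)
  moreover have "(\<Sum>k\<in>A. \<bar>degenerate_fall lam y k * t ^ k / fact k\<bar>) \<le> sum ?g A"
    by (intro sum_mono degenerate_term_le)
  ultimately show ?thesis
    using s by (simp add: sums_iff)
qed

section \<open>Termwise integration of the degenerate exponential\<close>

lemma measurable_degenerate_fall [measurable]:
  "(\<lambda>y. degenerate_fall lam y k) \<in> borel_measurable borel"
  unfolding degenerate_fall_def by measurable

lemma eventually_abs_mult_less_1:
  "eventually (\<lambda>t::real. \<bar>lam * t\<bar> < 1) (nhds 0)"
proof -
  have "((\<lambda>t. \<bar>lam * t\<bar>) \<longlongrightarrow> \<bar>lam * 0\<bar>) (nhds 0)"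
    by (intro tendsto_intros filterlim_ident)
  then show ?thesis
    by (intro order_tendstoD) auto
qed

text \<open>The exponent \<open>?c t\<close> is continuous at 0 and vanishes there, so for small t
  it falls below the radius r of the moment generating function.\<close>

lemma mgf_near_0_obtain_radius:
  assumes "lam \<noteq> 0" "Y \<in> borel_measurable M" "mgf_near_0 M Y"
  obtains s where "s > 0" "\<And>t. \<bar>t\<bar> < s \<Longrightarrow> \<bar>lam * t\<bar> < 1"
    "\<And>t. \<bar>t\<bar> < s \<Longrightarrow> integrable M (\<lambda>\<omega>. exp (\<bar>Y \<omega>\<bar> * (- ln (1 - \<bar>lam * t\<bar>) / \<bar>lam\<bar>)))"
proof -
  note [measurable] = assms(2)
  obtain r where r: "r > 0" "\<And>t. \<bar>t\<bar> < r \<Longrightarrow> integrable M (\<lambda>\<omega>. exp (Y \<omega> * t))"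
    using assms(3) unfolding mgf_near_0_def by auto
  let ?c = "\<lambda>t. - ln (1 - \<bar>lam * t\<bar>) / \<bar>lam\<bar>"
  have "(?c \<longlongrightarrow> ?c 0) (nhds 0)"
    by (intro tendsto_intros filterlim_ident) (use assms in auto)
  then have "eventually (\<lambda>t. ?c t < r) (nhds 0)"
    using r(1) by (intro order_tendstoD) auto
  then have "eventually (\<lambda>t. ?c t < r \<and> \<bar>lam * t\<bar> < 1) (nhds 0)"
    using eventually_abs_mult_less_1 by (rule eventually_conj)
  then obtain s where s: "s > 0" "\<And>t. \<bar>t\<bar> < s \<Longrightarrow> ?c t < r \<and> \<bar>lam * t\<bar> < 1"
    unfolding eventually_nhds_metric dist_real_def by auto
  show thesis
  proof (rule that[OF s(1)])
    fix t :: real assume t: "\<bar>t\<bar> < s"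
    show "\<bar>lam * t\<bar> < 1" using s(2)[OF t] by simp
    \<comment> \<open>Since 0 < 1 - |lam t| <= 1, the logarithm is nonpositive. Hence both
      \<open>?c t\<close> and \<open>- ?c t\<close> lie within (-r, r).\<close>
    have c: "0 \<le> ?c t" "?c t < r"
      using s(2)[OF t] assms(1) by (auto intro!: divide_nonneg_nonneg simp: divide_le_0_iff)
    have "integrable M (\<lambda>\<omega>. exp (Y \<omega> * ?c t) + exp (Y \<omega> * - ?c t))"
      using c by (intro Bochner_Integration.integrable_add r(2)) auto
    then show "integrable M (\<lambda>\<omega>. exp (\<bar>Y \<omega>\<bar> * ?c t))"
      proof (rule Bochner_Integration.integrable_bound)
      \<comment> \<open>The exponent on the left is y * c or y * (- c), according to the sign of
        y.\<close>
      have "exp (\<bar>y\<bar> * c) \<le> exp (y * c) + exp (y * - c)" for y c :: real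
        by (cases "y \<ge> 0") simp_all
      then show "AE \<omega> in M. norm (exp (\<bar>Y \<omega>\<bar> * ?c t)) \<le> norm (exp (Y \<omega> * ?c t) + exp (Y \<omega> * - ?c t))"
        by (intro AE_I2) (simp only: real_norm_def abs_exp_cancel abs_of_pos add_pos_pos exp_gt_zero)
    qed measurable
  qed
qed

text \<open>Dominated convergence for the partial sums, with the exponential majorant as dominating
  function, gives both the integrability of the limit and the termwise integration.\<close>

lemma
  fixes Y :: "'a \<Rightarrow> real"
  assumes "lam \<noteq> 0" "\<bar>lam * t\<bar> < 1" "Y \<in> borel_measurable M"
    and int: "integrable M (\<lambda>\<omega>. exp (\<bar>Y \<omega>\<bar> * (- ln (1 - \<bar>lam * t\<bar>) / \<bar>lam\<bar>)))"
  shows integrable_degenerate_exp: "integrable M (\<lambda>\<omega>. degenerate_exp lam (Y \<omega>) t)"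
    and integral_degenerate_exp_sums:
      "(\<lambda>k. (\<integral>\<omega>. degenerate_fall lam (Y \<omega>) k \<partial>M) / fact k * t ^ k)
         sums (\<integral>\<omega>. degenerate_exp lam (Y \<omega>) t \<partial>M)"
proof -
  note [measurable] = assms(3)
  let ?f = "\<lambda>k \<omega>. degenerate_fall lam (Y \<omega>) k * t ^ k / fact k"
  let ?w = "\<lambda>\<omega>. exp (\<bar>Y \<omega>\<bar> * (- ln (1 - \<bar>lam * t\<bar>) / \<bar>lam\<bar>))"
  have lim: "(\<lambda>n. \<Sum>k<n. ?f k \<omega>) \<longlonglongrightarrow> degenerate_exp lam (Y \<omega>) t" for \<omega>
    using degenerate_exp_sums[OF assms(1,2)] degenerate_exp_eq_powr[OF assms(1,2)]
    by (simp add: sums_def)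
  have bound: "norm (\<Sum>k<n. ?f k \<omega>) \<le> ?w \<omega>" for n \<omega>
    using order_trans[OF sum_abs sum_abs_degenerate_le_exp[OF assms(1,2)]] by simp
  have meas: "(\<lambda>\<omega>. degenerate_exp lam (Y \<omega>) t) \<in> borel_measurable M"
    by (rule borel_measurable_LIMSEQ_real[OF lim]) measurable
  \<comment> \<open>Integrability of each term lets the integral pass through the finite partial
    sums at the end.\<close>
  have term_int: "integrable M (?f k)" for k
    using int
  proof (rule Bochner_Integration.integrable_bound)
    show "AE \<omega> in M. norm (?f k \<omega>) \<le> norm (?w \<omega>)"
      using sum_abs_degenerate_le_exp[OF assms(1,2), of "{k}"] by simp
  qed measurable
  show "integrable M (\<lambda>\<omega>. degenerate_exp lam (Y \<omega>) t)"
    by (rule integrable_dominated_convergence[OF meas _ int, of "\<lambda>n \<omega>. \<Sum>k<n. ?f k \<omega>"])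
      (use lim bound in auto)
  have "(\<lambda>n. \<integral>\<omega>. (\<Sum>k<n. ?f k \<omega>) \<partial>M) \<longlonglongrightarrow> (\<integral>\<omega>. degenerate_exp lam (Y \<omega>) t \<partial>M)"
    by (rule integral_dominated_convergence[OF meas _ int]) (use lim bound in auto)
  then show "(\<lambda>k. (\<integral>\<omega>. degenerate_fall lam (Y \<omega>) k \<partial>M) / fact k * t ^ k)
         sums (\<integral>\<omega>. degenerate_exp lam (Y \<omega>) t \<partial>M)"
    using term_int by (simp add: sums_def)
qed

section \<open>Formal power series of the degenerate exponential\<close>

lemma has_fps_expansion_realI:
  fixes f :: "real \<Rightarrow> real"
  assumes "s > 0" "\<And>t. \<bar>t\<bar> < s \<Longrightarrow> (\<lambda>k. a k * t ^ k) sums f t"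
  shows "f has_fps_expansion Abs_fps a"
  by (rule has_fps_expansionI)
     (use assms in \<open>auto simp: eventually_nhds_metric dist_real_def intro!: exI[of _ s]\<close>)

lemma has_fps_expansion_eventually_eq:
  assumes "eventually (\<lambda>t. f t = g t) (nhds 0)" "g has_fps_expansion F"
  shows "f has_fps_expansion F"
proof -
  have "eventually (\<lambda>t. eval_fps F t = g t) (nhds 0)"
    using assms(2) by (simp add: has_fps_expansion_def)
  with assms(1) have "eventually (\<lambda>t. eval_fps F t = f t) (nhds 0)"
    by eventually_elim simp
  with assms(2) show ?thesis
    by (simp add: has_fps_expansion_def)
qed

definition degenerate_fps :: "real \<Rightarrow> real \<Rightarrow> real fps" where
  "degenerate_fps lam x = Abs_fps (\<lambda>k. degenerate_fall lam x k / fact k)"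

lemma fps_nth_degenerate_fps [simp]:
  "fps_nth (degenerate_fps lam x) k = degenerate_fall lam x k / fact k"
  by (simp add: degenerate_fps_def)

lemma degenerate_exp_has_fps_expansion:
  assumes "lam \<noteq> 0"
  shows "degenerate_exp lam x has_fps_expansion degenerate_fps lam x"
  unfolding degenerate_fps_def
proof (rule has_fps_expansion_realI)
  show "0 < 1 / \<bar>lam\<bar>" using assms by simp
  fix t :: real assume "\<bar>t\<bar> < 1 / \<bar>lam\<bar>"
  then have "\<bar>lam * t\<bar> < 1" using assms by (simp add: abs_mult field_simps)
  then show "(\<lambda>k. degenerate_fall lam x k / fact k * t ^ k) sums degenerate_exp lam x t"
    using degenerate_exp_sums[OF assms] degenerate_exp_eq_powr[OF assms] by simp
qed

lemma degenerate_fps_0 [simp]: "degenerate_fps lam 0 = 1"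
proof (rule fps_ext)
  \<comment> \<open>For positive k the factor with index 0 is 0; the shifted product rule splits it
    off.\<close>
  show "fps_nth (degenerate_fps lam 0) k = fps_nth 1 k" for k
    by (cases k) (simp_all add: degenerate_fall_def prod.lessThan_Suc_shift del: prod.lessThan_Suc)
qed

lemma degenerate_exp_add:
  assumes "lam \<noteq> 0" "\<bar>lam * t\<bar> < 1"
  shows "degenerate_exp lam (x + y) t = degenerate_exp lam x t * degenerate_exp lam y t"
  using assms by (simp add: degenerate_exp_eq_powr powr_add add_divide_distrib)

text \<open>Coefficientwise this is a Vandermonde convolution. It is obtained analytically: both
  sides expand the same germ at 0, by the exponent law for real powers, and expansions are
  unique.\<close>

lemma degenerate_fps_add:
  assumes "lam \<noteq> 0"
  shows "degenerate_fps lam (x + y) = degenerate_fps lam x * degenerate_fps lam y"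
proof (rule has_fps_expansion_unique_real)
  show "degenerate_exp lam (x + y) has_fps_expansion degenerate_fps lam (x + y)"
    by (rule degenerate_exp_has_fps_expansion[OF assms])
  have "eventually (\<lambda>t. degenerate_exp lam (x + y) t = degenerate_exp lam x t * degenerate_exp lam y t) (nhds 0)"
    using eventually_abs_mult_less_1[of lam]
    by eventually_elim (rule degenerate_exp_add[OF assms])
  then show "degenerate_exp lam (x + y) has_fps_expansion degenerate_fps lam x * degenerate_fps lam y"
    using has_fps_expansion_mult[OF degenerate_exp_has_fps_expansion[OF assms]
        degenerate_exp_has_fps_expansion[OF assms], of x y]
    by (rule has_fps_expansion_eventually_eq)
qed

section \<open>Moment series and independence\<close>

context prob_space
begin

definition degenerate_moment_fps :: "real \<Rightarrow> ('a \<Rightarrow> real) \<Rightarrow> real fps" where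
  "degenerate_moment_fps lam Y =
     Abs_fps (\<lambda>k. expectation (\<lambda>\<omega>. degenerate_fall lam (Y \<omega>) k) / fact k)"

text \<open>The constant coefficient is the total mass of the probability measure; being nonzero, it
  makes the series invertible.\<close>

lemma degenerate_moment_fps_nth_0 [simp]: "fps_nth (degenerate_moment_fps lam Y) 0 = 1"
  by (simp add: degenerate_moment_fps_def degenerate_fall_def prob_space)

lemma expectation_degenerate_exp_has_fps_expansion:
  assumes "lam \<noteq> 0" "Y \<in> borel_measurable M" "mgf_near_0 M Y"
  shows "(\<lambda>t. expectation (\<lambda>\<omega>. degenerate_exp lam (Y \<omega>) t))
           has_fps_expansion degenerate_moment_fps lam Y"
proof -
  obtain s where s: "s > 0" "\<And>t. \<bar>t\<bar> < s \<Longrightarrow> \<bar>lam * t\<bar> < 1"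
    "\<And>t. \<bar>t\<bar> < s \<Longrightarrow> integrable M (\<lambda>\<omega>. exp (\<bar>Y \<omega>\<bar> * (- ln (1 - \<bar>lam * t\<bar>) / \<bar>lam\<bar>)))"
    using mgf_near_0_obtain_radius[OF assms] by blast
  show ?thesis
    unfolding degenerate_moment_fps_def
    by (rule has_fps_expansion_realI[OF s(1)])
      (rule integral_degenerate_exp_sums[OF assms(1) s(2) assms(2) s(3)])
qed

lemma eventually_integrable_degenerate_exp:
  assumes "lam \<noteq> 0" "Y \<in> borel_measurable M" "mgf_near_0 M Y"
  shows "eventually (\<lambda>t. integrable M (\<lambda>\<omega>. degenerate_exp lam (Y \<omega>) t)) (nhds 0)"
proof -
  obtain s where s: "s > 0" "\<And>t. \<bar>t\<bar> < s \<Longrightarrow> \<bar>lam * t\<bar> < 1"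
    "\<And>t. \<bar>t\<bar> < s \<Longrightarrow> integrable M (\<lambda>\<omega>. exp (\<bar>Y \<omega>\<bar> * (- ln (1 - \<bar>lam * t\<bar>) / \<bar>lam\<bar>)))"
    using mgf_near_0_obtain_radius[OF assms] by blast
  then show ?thesis
    using integrable_degenerate_exp[OF assms(1) s(2) assms(2) s(3)]
    by (auto simp: eventually_nhds_metric dist_real_def)
qed

text \<open>The expansion for the sum is read off from the product of the two expectations, which
  agrees with its expectation for t near 0. Integrability of both factors is what the product rule
  for independent variables asks for.\<close>

lemma expectation_degenerate_exp_add_has_fps_expansion:
  assumes "lam \<noteq> 0" and indep: "indep_var borel Y1 borel Y2"
    and "mgf_near_0 M Y1" "mgf_near_0 M Y2"
  shows "(\<lambda>t. expectation (\<lambda>\<omega>. degenerate_exp lam (Y1 \<omega> + Y2 \<omega>) t))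
           has_fps_expansion degenerate_moment_fps lam Y1 * degenerate_moment_fps lam Y2"
proof -
  let ?E = "\<lambda>Y t. expectation (\<lambda>\<omega>. degenerate_exp lam (Y \<omega>) t)"
  note rv = indep_var_rv1[OF indep] indep_var_rv2[OF indep]
  have "eventually (\<lambda>t. ?E (\<lambda>\<omega>. Y1 \<omega> + Y2 \<omega>) t = ?E Y1 t * ?E Y2 t) (nhds 0)"
    using eventually_integrable_degenerate_exp[OF assms(1) rv(1) assms(3)]
      eventually_integrable_degenerate_exp[OF assms(1) rv(2) assms(4)]
      eventually_abs_mult_less_1[of lam]
  proof eventually_elim
    case (elim t)
    \<comment> \<open>For t inside the disc of convergence, the closed form as a real power shows
      measurability in the exponent.\<close>
    have [measurable]: "(\<lambda>y. degenerate_exp lam y t) \<in> borel_measurable borel"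
      unfolding degenerate_exp_eq_powr[OF assms(1) elim(3)] by measurable
    have "indep_var borel ((\<lambda>y. degenerate_exp lam y t) \<circ> Y1) borel ((\<lambda>y. degenerate_exp lam y t) \<circ> Y2)"
      by (rule indep_var_compose[OF indep]) measurable
    then show ?case
      using indep_var_lebesgue_integral elim
      by (simp add: degenerate_exp_add[OF assms(1)] comp_def)
  qed
  then show ?thesis
    using has_fps_expansion_mult[OF expectation_degenerate_exp_has_fps_expansion[OF assms(1) rv(1) assms(3)]
        expectation_degenerate_exp_has_fps_expansion[OF assms(1) rv(2) assms(4)]]
    by (rule has_fps_expansion_eventually_eq)
qed

end

section \<open>Sheffer values as coefficients, and the Cauchy product\<close>

lemma sheffer_eq_fps_nth:
  assumes "lam \<noteq> 0"
    and "(\<lambda>t. prob_space.expectation M (\<lambda>\<omega>. degenerate_exp lam (Y \<omega>) t)) has_fps_expansion F"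
    and "fps_nth F 0 \<noteq> 0"
  shows "sheffer M lam Y n x = fact n * fps_nth (inverse F * degenerate_fps lam x) n"
proof -
  have "sheffer_gf M lam Y x has_fps_expansion inverse F * degenerate_fps lam x"
    using has_fps_expansion_mult[OF has_fps_expansion_inverse[OF assms(2,3)]
        degenerate_exp_has_fps_expansion[OF assms(1), of x]]
    by (simp add: sheffer_gf_def[abs_def] inverse_eq_divide)
  then show ?thesis
    by (intro sheffer_eqI) (simp add: fps_nth_inverse)
qed

lemma fact_mult_fps_mult_nth:
  fixes A B :: "real fps"
  shows "fact n * fps_nth (A * B) n =
    (\<Sum>k=0..n. real (n choose k) * (fact k * fps_nth A k) * (fact (n - k) * fps_nth B (n - k)))"
  unfolding fps_mult_nth sum_distrib_left
  \<comment> \<open>The factorials combine through n! = (n choose k) * k! * (n - k)!.\<close>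
  by (intro sum.cong) (auto simp: binomial_fact field_simps)

theorem theorem3p2:
  fixes M :: "'a measure" and Y1 :: "'a \<Rightarrow> real" and lam :: real
  assumes "prob_space M"
    and "lam \<noteq> 0"
    and "Y1 \<in> borel_measurable M"
    and "mgf_near_0 M Y1"
  shows "(\<forall>Y2 :: 'a \<Rightarrow> real.
            prob_space.indep_var M borel Y1 borel Y2 \<longrightarrow> mgf_near_0 M Y2 \<longrightarrow>
            (\<forall>(n::nat) (x::real) (y::real).
               sheffer M lam (\<lambda>\<omega>. Y1 \<omega> + Y2 \<omega>) n (x + y) =
                 (\<Sum>k=0..n. real (n choose k) * sheffer M lam Y1 k x * sheffer M lam Y2 (n - k) y)))
       \<and> (\<forall>(n::nat) (x::real).
            sheffer M lam Y1 n x =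
              (\<Sum>k=0..n. real (n choose k) * sheffer M lam Y1 k 0 * degenerate_fall lam x (n - k)))"
proof -
  interpret prob_space M by fact
  let ?F = "degenerate_moment_fps lam" and ?D = "degenerate_fps lam"
  have S: "sheffer M lam Y n x = fact n * fps_nth (inverse (?F Y) * ?D x) n"
    if "Y \<in> borel_measurable M" "mgf_near_0 M Y" for Y n x
    using that assms(2)
    by (intro sheffer_eq_fps_nth expectation_degenerate_exp_has_fps_expansion) auto
  have "sheffer M lam (\<lambda>\<omega>. Y1 \<omega> + Y2 \<omega>) n (x + y) =
      (\<Sum>k=0..n. real (n choose k) * sheffer M lam Y1 k x * sheffer M lam Y2 (n - k) y)"
    if indep: "indep_var borel Y1 borel Y2" and mgf: "mgf_near_0 M Y2" for Y2 n x y
  proof -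
    \<comment> \<open>\<open>sheffer_eq_fps_nth\<close> asks only for an expansion with nonzero
      constant coefficient, so the product of the two moment series serves directly for the
      sum.\<close>
    have "sheffer M lam (\<lambda>\<omega>. Y1 \<omega> + Y2 \<omega>) n (x + y) =
        fact n * fps_nth (inverse (?F Y1 * ?F Y2) * ?D (x + y)) n"
      using expectation_degenerate_exp_add_has_fps_expansion[OF assms(2) indep assms(4) mgf]
      by (intro sheffer_eq_fps_nth[OF assms(2)]) auto
    also have "inverse (?F Y1 * ?F Y2) * ?D (x + y) =
        (inverse (?F Y1) * ?D x) * (inverse (?F Y2) * ?D y)"
      by (simp add: fps_inverse_mult degenerate_fps_add[OF assms(2)] mult_ac)
    finally show ?thesis
      unfolding fact_mult_fps_mult_nth[of n "inverse (?F Y1) * ?D x"]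
      by (simp only: S[OF assms(3,4)] S[OF indep_var_rv2[OF indep] mgf])
  qed
  \<comment> \<open>Here the Cauchy product is split as \<open>inverse (?F Y1)\<close> times
    \<open>?D x\<close>. As \<open>?D 0\<close> is 1, the first factor generates the values at 0,
    and the second generates the degenerate falling factorials.\<close>
  moreover have "sheffer M lam Y1 n x =
      (\<Sum>k=0..n. real (n choose k) * sheffer M lam Y1 k 0 * degenerate_fall lam x (n - k))" for n x
    using fact_mult_fps_mult_nth[of n "inverse (?F Y1)" "?D x"] by (simp add: S[OF assms(3,4)])
  ultimately show ?thesis
    by blast
qed

end
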